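(* Let $\mu:G\times H\to K$ be a graph homomorphism, where $K$ is square-free. Let $g_0g_1$ be an oriented edge of $G$ and $h_0h_1$ an oriented edge of $H$. Then one of the following holds: (i) $\overline{\mu(C)}=\varepsilon$ for every closed walk $C$ from $(g_0,h_0)$ in $G\times h_0h_1$; (ii) $\overline{\mu(D)}=\varepsilon$ for every closed walk $D$ from $(g_0,h_0)$ in $g_0g_1\times H$; (iii) there is $R\in\pi(K)$ such that for every closed walk $C'$ from $(g_0,h_0)$ in $G\times H$, $\overline{\mu(C')}=R^{i}$ for some $i\in\mathbb{Z}$.
   Context: All graphs are finite, simple, loopless; every graph has at least two vertices and no isolated vertices. $G\times H$ is the tensor product (vertices $V(G)\times V(H)$, $(g,h)(g',h')$ an edge iff $gg'\in E(G)$ and $hh'\in E(H)$). For an edge $h_0h_1$ of $H$, $G\times h_0h_1$ is the subgraph of $G\times H$ induced by $V(G)\times\{h_0,h_1\}$; $g_0g_1\times H$ is defined symmetrically. A graph is square-free if there are no four pairwise distinct vertices $v_1,v_2,v_3,v_4$ with $v_1v_2,v_2v_3,v_3v_4,v_4v_1$ edges. A walk is a sequence of oriented edges each starting where the previous ends; $\mu(W)$ is the image of a walk under $\mu$; $\overline{W}$ is the reduced walk obtained by repeatedly deleting consecutive pairs $e,e^{-1}$; $\varepsilon$ is the empty walk. $\pi(K)$ is the fundamental groupoid: reduced walks with $W\cdot W'=\overline{WW'}$ and inversion by reversal; $R^i$ is the $i$-fold product (with $R^0=\varepsilon$, $R^{-i}=(R^{-1})^i$). *)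

theory Defs
  imports "Graph_Theory.Kuratowski"
begin

text \<open>
  An undirected edge is a pair of mutually inverse arcs; oriented edges are arcs, walks are arc
  lists, and \<^const>\<open>progressing\<close> walks are the reduced ones.
\<close>

definition simple_graph :: "'a pair_pre_digraph \<Rightarrow> bool" where
  "simple_graph G \<longleftrightarrow> pair_graph G \<and> 2 \<le> card (pverts G) \<and>
     (\<forall>v\<in>pverts G. \<exists>w. (v, w) \<in> parcs G)"

definition tensor_product ::
    "'a pair_pre_digraph \<Rightarrow> 'b pair_pre_digraph \<Rightarrow> ('a \<times> 'b) pair_pre_digraph" where
  "tensor_product G H = \<lparr> pverts = pverts G \<times> pverts H,
     parcs = {((g, h), (g', h')) | g h g' h'. (g, g') \<in> parcs G \<and> (h, h') \<in> parcs H} \<rparr>"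

definition graph_hom ::
    "('a \<Rightarrow> 'b) \<Rightarrow> 'a pair_pre_digraph \<Rightarrow> 'b pair_pre_digraph \<Rightarrow> bool" where
  "graph_hom f G K \<longleftrightarrow> (\<forall>v\<in>pverts G. f v \<in> pverts K) \<and>
     (\<forall>u v. (u, v) \<in> parcs G \<longrightarrow> (f u, f v) \<in> parcs K)"

definition square_free :: "'a pair_pre_digraph \<Rightarrow> bool" where
  "square_free K \<longleftrightarrow> \<not> (\<exists>v1 v2 v3 v4. distinct [v1, v2, v3, v4] \<and>
     (v1, v2) \<in> parcs K \<and> (v2, v3) \<in> parcs K \<and> (v3, v4) \<in> parcs K \<and> (v4, v1) \<in> parcs K)"

definition walk_image :: "('a \<Rightarrow> 'b) \<Rightarrow> ('a \<times> 'a) awalk \<Rightarrow> ('b \<times> 'b) awalk" where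
  "walk_image f W = map (map_prod f f) W"

inductive cancel_step :: "('a \<times> 'a) awalk \<Rightarrow> ('a \<times> 'a) awalk \<Rightarrow> bool" where
  "cancel_step (xs @ (x, y) # (y, x) # ys) (xs @ ys)"

definition reduce_walk :: "('a \<times> 'a) awalk \<Rightarrow> ('a \<times> 'a) awalk" where
  "reduce_walk W = (THE W'. cancel_step\<^sup>*\<^sup>* W W' \<and> progressing W')"

text \<open>
  \<open>pi_hom K u v\<close> is the set of morphisms from \<open>u\<close> to \<open>v\<close> in the fundamental groupoid of \<open>K\<close>.
  Walks do not record their end points, so the identity at every vertex is \<open>[]\<close>. Products and
  powers are meaningful only for composable walks, hence powers only for closed ones.
\<close>

definition pi_hom :: "'a pair_pre_digraph \<Rightarrow> 'a \<Rightarrow> 'a \<Rightarrow> ('a \<times> 'a) awalk set" where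
  "pi_hom K u v = {W. pre_digraph.awalk (with_proj K) u W v \<and> progressing W}"

definition pi_mult :: "('a \<times> 'a) awalk \<Rightarrow> ('a \<times> 'a) awalk \<Rightarrow> ('a \<times> 'a) awalk" where
  "pi_mult W W' = reduce_walk (W @ W')"

definition pi_pow :: "('a \<times> 'a) awalk \<Rightarrow> int \<Rightarrow> ('a \<times> 'a) awalk" where
  "pi_pow R i = (if 0 \<le> i then (pi_mult R ^^ nat i) []
                 else (pi_mult (rev_path R) ^^ nat (- i)) [])"

text \<open>
  The reduced walk is unique. The function \<open>stack_reduce\<close> is only used to show this.
\<close>

definition push :: "'a \<times> 'a \<Rightarrow> ('a \<times> 'a) awalk \<Rightarrow> ('a \<times> 'a) awalk" where
  "push e W = (case W of [] \<Rightarrow> [e] | e' # W' \<Rightarrow> if e' = prod.swap e then W' else e # W)"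

definition stack_reduce :: "('a \<times> 'a) awalk \<Rightarrow> ('a \<times> 'a) awalk" where
  "stack_reduce W = foldr push W []"

lemma progressing_push: "progressing W \<Longrightarrow> progressing (push e W)"
  by (cases e) (auto simp: push_def progressing_Nil progressing_Cons prod_eq_iff
      split: list.split)

lemma progressing_foldr_push: "progressing V \<Longrightarrow> progressing (foldr push W V)"
  by (induction W) (auto intro: progressing_push)

lemma push_push_swap:
  assumes "progressing W"
  shows "push (x, y) (push (y, x) W) = W"
proof (cases W)
  case Nil
  then show ?thesis by (simp add: push_def)
next
  case (Cons e W')
  show ?thesis
  proof (cases "e = (x, y)")
    case True
    then have "W' = [] \<or> hd W' \<noteq> (y, x)"
      using assms Cons by (auto simp: progressing_Cons)
    then show ?thesis
      using Cons True by (auto simp: push_def split: list.split)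
  qed (use Cons in \<open>simp add: push_def\<close>)
qed

lemma stack_reduce_cancel_step:
  "cancel_step W W' \<Longrightarrow> stack_reduce W = stack_reduce W'"
  by (induction rule: cancel_step.induct)
    (simp add: stack_reduce_def push_push_swap progressing_foldr_push progressing_Nil)

lemma stack_reduce_cancel_steps:
  "cancel_step\<^sup>*\<^sup>* W W' \<Longrightarrow> stack_reduce W = stack_reduce W'"
  by (induction rule: rtranclp_induct) (auto dest: stack_reduce_cancel_step)

lemma stack_reduce_progressing: "progressing W \<Longrightarrow> stack_reduce W = W"
proof (induction W)
  case (Cons e W)
  then have "stack_reduce W = W" by (blast dest: progressing_ConsD)
  then show ?case
    using Cons.prems
    by (cases e) (auto simp: stack_reduce_def push_def progressing_Cons split: list.split)
qed (simp add: stack_reduce_def)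

lemma cancel_step_Cons: "cancel_step W W' \<Longrightarrow> cancel_step (e # W) (e # W')"
  by (induction rule: cancel_step.induct) (metis append_Cons cancel_step.intros)

lemma cancel_steps_Cons: "cancel_step\<^sup>*\<^sup>* W W' \<Longrightarrow> cancel_step\<^sup>*\<^sup>* (e # W) (e # W')"
  by (induction rule: rtranclp_induct) (auto dest: cancel_step_Cons intro: rtranclp.rtrancl_into_rtrancl)

lemma cancel_steps_push: "cancel_step\<^sup>*\<^sup>* (e # W) (push e W)"
proof (cases "\<exists>W'. W = prod.swap e # W'")
  case True
  then show ?thesis
    using cancel_step.intros[of "[]" "fst e" "snd e"]
    by (cases e) (auto simp: push_def)
qed (auto simp: push_def split: list.split)

lemma cancel_steps_stack_reduce: "cancel_step\<^sup>*\<^sup>* W (stack_reduce W)"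
proof (induction W)
  case (Cons e W)
  then have "cancel_step\<^sup>*\<^sup>* (e # W) (e # stack_reduce W)" by (rule cancel_steps_Cons)
  also have "cancel_step\<^sup>*\<^sup>* (e # stack_reduce W) (push e (stack_reduce W))"
    by (rule cancel_steps_push)
  finally show ?case by (simp add: stack_reduce_def)
qed (simp add: stack_reduce_def)

lemma ex1_reduced: "\<exists>!W'. cancel_step\<^sup>*\<^sup>* W W' \<and> progressing W'"
proof (rule ex1I[of _ "stack_reduce W"])
  show "cancel_step\<^sup>*\<^sup>* W (stack_reduce W) \<and> progressing (stack_reduce W)"
    by (simp add: cancel_steps_stack_reduce)
      (simp add: stack_reduce_def progressing_foldr_push progressing_Nil)
qed (metis stack_reduce_cancel_steps stack_reduce_progressing)

lemma reduce_walk: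
  "cancel_step\<^sup>*\<^sup>* W (reduce_walk W)" "progressing (reduce_walk W)"
  using theI'[OF ex1_reduced[of W]] unfolding reduce_walk_def by auto

lemma reduce_walk_unique:
  "cancel_step\<^sup>*\<^sup>* W W' \<Longrightarrow> progressing W' \<Longrightarrow> reduce_walk W = W'"
  using ex1_reduced[of W] reduce_walk[of W] by blast

end

theory Submission
  imports Defs "HOL-Algebra.Group"
begin

text \<open>
  Since \<open>K\<close> is square-free, the reduction of the image of a walk of length two depends only on its
  end points. Hence the reduction of the image of an even closed walk from \<open>(g0, h0)\<close> is the product
  of the class of a closed walk in \<open>G \<times> h0h1\<close> and the class of a closed walk in \<open>g0g1 \<times> H\<close>, and
  classes of these two kinds commute. In the group of reduced words over loopless letters the
  centralizer of a nontrivial element is cyclic. So if neither (i) nor (ii) holds, with \<open>x \<noteq> \<epsilon>\<close> the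
  class of a closed walk in \<open>G \<times> h0h1\<close>, then all even closed walks have their class in the
  centralizer of \<open>x\<close>. For an odd closed walk with class \<open>z\<close>, the element \<open>z\<^sup>2\<close> is nontrivial and
  commutes with \<open>x\<close> and \<open>z\<close>, so \<open>z\<close> commutes with \<open>x\<close> too.
\<close>

section \<open>The group of reduced words\<close>

lemma cancel_step_context: "cancel_step W W' \<Longrightarrow> cancel_step (U @ W @ V) (U @ W' @ V)"
proof (induction rule: cancel_step.induct)
  case (1 xs x y ys)
  show ?case
    using cancel_step.intros[of "U @ xs" x y "ys @ V"] by simp
qed

lemma cancel_steps_context: "cancel_step\<^sup>*\<^sup>* W W' \<Longrightarrow> cancel_step\<^sup>*\<^sup>* (U @ W @ V) (U @ W' @ V)"
  by (induction rule: rtranclp_induct)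
    (auto dest: cancel_step_context intro: rtranclp.rtrancl_into_rtrancl)

lemma reduce_walk_cancel_steps: "cancel_step\<^sup>*\<^sup>* W W' \<Longrightarrow> reduce_walk W = reduce_walk W'"
  by (meson reduce_walk reduce_walk_unique rtranclp_trans)

lemma reduce_walk_cancel: "reduce_walk (U @ (x, y) # (y, x) # V) = reduce_walk (U @ V)"
  by (intro reduce_walk_cancel_steps r_into_rtranclp cancel_step.intros)

lemma reduce_walk_progressing [simp]: "progressing W \<Longrightarrow> reduce_walk W = W"
  by (simp add: reduce_walk_unique)

text \<open>Cancelling inside the middle segment first is one order of cancelling in the whole word,
  and the reduced form does not depend on the order. Associativity of the group rests on
  this.\<close>

lemma reduce_walk_context: "reduce_walk (U @ reduce_walk W @ V) = reduce_walk (U @ W @ V)"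
  by (rule reduce_walk_cancel_steps[OF cancel_steps_context[OF reduce_walk(1)], symmetric])

lemma reduce_walk_append_left: "reduce_walk (reduce_walk W @ V) = reduce_walk (W @ V)"
  using reduce_walk_context[of "[]"] by simp

lemma reduce_walk_append_right: "reduce_walk (U @ reduce_walk W) = reduce_walk (U @ W)"
  using reduce_walk_context[of _ _ "[]"] by simp

lemma pi_mult_reduce_walk: "pi_mult (reduce_walk V) (reduce_walk W) = reduce_walk (V @ W)"
  by (simp add: pi_mult_def reduce_walk_append_left reduce_walk_append_right)

text \<open>Each step deletes exactly two letters, so parity is kept and equal lengths mean that no
  step took place. The deleted pair goes out and back, so a walk stays a walk.\<close>

lemma cancel_steps_invariants:
  assumes "cancel_step\<^sup>*\<^sup>* W W'"
  shows "length W' \<le> length W \<and> (length W' = length W \<longrightarrow> W' = W) \<and>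
    even (length W') = even (length W) \<and> set W' \<subseteq> set W \<and> (pcas u W v \<longrightarrow> pcas u W' v)"
  using assms
proof (induction rule: rtranclp_induct)
  case (step V V')
  have "pcas u (xs @ (x, y) # (y, x) # ys) v \<longrightarrow> pcas u (xs @ ys) v" for xs x y ys
    by (induction xs arbitrary: u) auto
  with step.hyps(2) have "length V = length V' + 2 \<and> set V' \<subseteq> set V \<and> (pcas u V v \<longrightarrow> pcas u V' v)"
    by cases auto
  with step.IH show ?case by auto
qed simp

lemmas reduce_walk_invariants = cancel_steps_invariants[OF reduce_walk(1)]

lemma rev_path_conv_rev: "rev_path W = map prod.swap (rev W)"
  by (induction W) (auto simp: prod.swap_def)

lemma set_rev_path: "set (rev_path W) = prod.swap ` set W"
  by (simp add: rev_path_conv_rev)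

lemma hd_rev_path: "W \<noteq> [] \<Longrightarrow> hd (rev_path W) = prod.swap (last W)"
  by (simp add: rev_path_conv_rev hd_map hd_rev)

lemma reduce_walk_rev_path_append: "reduce_walk (rev_path W @ W) = []"
proof (induction W)
  case (Cons e W)
  then show ?case
    using reduce_walk_cancel[of "rev_path W" "snd e" "fst e" W] by simp
qed (simp add: progressing_Nil)

definition reduced_words :: "('a \<times> 'a) awalk monoid" where
  "reduced_words = \<lparr>carrier = {W. progressing W}, mult = pi_mult, one = []\<rparr>"

lemma reduced_words_simps [simp]:
  "carrier reduced_words = {W. progressing W}"
  "V \<otimes>\<^bsub>reduced_words\<^esub> W = pi_mult V W"
  "\<one>\<^bsub>reduced_words\<^esub> = []"
  by (simp_all add: reduced_words_def)

interpretation reduced_words: group reduced_words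
  rewrites "carrier reduced_words = {W. progressing W}"
    and "mult reduced_words = pi_mult"
    and "one reduced_words = []"
proof -
  show "group (reduced_words :: ('a \<times> 'a) awalk monoid)"
  proof (rule groupI)
    fix W :: "('a \<times> 'a) awalk"
    assume "W \<in> carrier reduced_words"
    then show "\<exists>V\<in>carrier reduced_words. V \<otimes>\<^bsub>reduced_words\<^esub> W = \<one>\<^bsub>reduced_words\<^esub>"
      by (intro bexI[of _ "rev_path W"])
        (simp_all add: pi_mult_def reduce_walk_rev_path_append progressing_rev_path)
  qed (simp_all add: pi_mult_def reduce_walk progressing_Nil reduce_walk_append_left
      reduce_walk_append_right)
qed (simp_all add: reduced_words_def)

lemma inv_reduced_words [simp]:
  "progressing W \<Longrightarrow> inv\<^bsub>reduced_words\<^esub> W = rev_path W"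
  by (rule reduced_words.inv_equality)
    (simp_all add: pi_mult_def reduce_walk_rev_path_append progressing_rev_path)

lemma pi_pow_conv_int_pow:
  assumes "progressing R"
  shows "pi_pow R i = R [^]\<^bsub>reduced_words\<^esub> i"
proof -
  have pow: "(pi_mult W ^^ n) [] = W [^]\<^bsub>reduced_words\<^esub> n" if "progressing W" for W n
  proof (induction n)
    case (Suc n)
    then show ?case
      \<comment> \<open>The iterate of \<open>pi_mult W\<close> multiplies on the left, the group
        power on the right.\<close>
      using reduced_words.nat_pow_Suc2[of W n] that by simp
  qed simp
  show ?thesis
    using assms
    using reduced_words.nat_pow_inv[of R "nat (- i)"]
    by (simp add: pi_pow_def int_pow_def2 pow progressing_rev_path del: pow_nat)
qed

section \<open>Centralizers\<close>

lemma (in group) subgroup_conjugate: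
  assumes "subgroup S G" "a \<in> carrier G"
  shows "subgroup ((\<lambda>s. inv a \<otimes> s \<otimes> a) ` S) G"
proof -
  interpret S: subgroup S G by fact
  have 1: "(inv a \<otimes> s \<otimes> a) \<otimes> (inv a \<otimes> t \<otimes> a) = inv a \<otimes> (s \<otimes> t) \<otimes> a"
    if "s \<in> S" "t \<in> S" for s t
    using that assms(2) by (simp add: m_assoc inv_solve_left) (simp flip: m_assoc)
  have 2: "inv (inv a \<otimes> s \<otimes> a) = inv a \<otimes> inv s \<otimes> a" if "s \<in> S" for s
    using that assms(2) by (simp add: inv_mult_group m_assoc)
  show ?thesis
    by (rule subgroupI) (use assms(2) S.one_closed in \<open>auto simp: 1 2 simp del: S.one_closed\<close>)
qed

text \<open>Conjugation by \<open>a\<close> is an endomorphism, and endomorphisms respect integer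
  powers.\<close>

lemma (in group) int_pow_conjugate:
  assumes "a \<in> carrier G" "r \<in> carrier G"
  shows "(a \<otimes> r \<otimes> inv a) [^] (i :: int) = a \<otimes> r [^] i \<otimes> inv a"
proof -
  have "(a \<otimes> x \<otimes> inv a) \<otimes> (a \<otimes> y \<otimes> inv a) = a \<otimes> (x \<otimes> y) \<otimes> inv a"
    if "x \<in> carrier G" "y \<in> carrier G" for x y
    using that assms(1) by (simp add: m_assoc inv_solve_left) (simp flip: m_assoc)
  then have "(\<lambda>r. a \<otimes> r \<otimes> inv a) \<in> hom G G"
    using assms(1) by (intro homI) auto
  then show ?thesis
    using hom_int_pow[of "\<lambda>r. a \<otimes> r \<otimes> inv a" G G r i] assms(2) is_group by simp
qed

lemma (in group) commute_inv:
  assumes "x \<otimes> y = y \<otimes> x" "x \<in> carrier G" "y \<in> carrier G"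
  shows "x \<otimes> inv y = inv y \<otimes> x"
  using assms by (metis inv_closed inv_solve_left inv_solve_right m_assoc m_closed)

text \<open>If \<open>y\<close> commutes with the conjugate of \<open>z\<close> by \<open>a\<close>,
  then conjugating \<open>y\<close> back gives an element commuting with \<open>z\<close>. That
  element is a power of the conjugated \<open>r\<close>, and conjugation preserves powers.\<close>

lemma (in group) centralizer_cyclic_conjugate:
  assumes S: "subgroup S G" and a: "a \<in> carrier G" and z: "z \<in> carrier G"
    and cyc: "\<exists>r\<in>(\<lambda>s. inv a \<otimes> s \<otimes> a) ` S. \<forall>y\<in>(\<lambda>s. inv a \<otimes> s \<otimes> a) ` S.
      z \<otimes> y = y \<otimes> z \<longrightarrow> (\<exists>i::int. y = r [^] i)"
  shows "\<exists>r\<in>S. \<forall>y\<in>S. (a \<otimes> z \<otimes> inv a) \<otimes> y = y \<otimes> (a \<otimes> z \<otimes> inv a) \<longrightarrow> (\<exists>i::int. y = r [^] i)"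
proof -
  interpret S: subgroup S G by fact
  obtain r where r: "r \<in> S" and cyc: "\<And>y. y \<in> S \<Longrightarrow>
      z \<otimes> (inv a \<otimes> y \<otimes> a) = (inv a \<otimes> y \<otimes> a) \<otimes> z \<Longrightarrow>
      \<exists>i::int. inv a \<otimes> y \<otimes> a = (inv a \<otimes> r \<otimes> a) [^] i"
    using cyc by blast
  have "\<exists>i::int. y = r [^] i"
    if y: "y \<in> S" and comm: "(a \<otimes> z \<otimes> inv a) \<otimes> y = y \<otimes> (a \<otimes> z \<otimes> inv a)" for y
  proof -
    have yc: "y \<in> carrier G" and rc: "r \<in> carrier G" using y r by auto
    have "z \<otimes> (inv a \<otimes> y \<otimes> a) = inv a \<otimes> ((a \<otimes> z \<otimes> inv a) \<otimes> y) \<otimes> a"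
      using a z yc by (simp add: m_assoc inv_solve_left)
    also have "\<dots> = (inv a \<otimes> y \<otimes> a) \<otimes> z"
      unfolding comm using a z yc by (simp add: m_assoc)
    finally obtain i :: int where "inv a \<otimes> y \<otimes> a = (inv a \<otimes> r \<otimes> a) [^] i"
      using cyc[OF y] by blast
    also have "\<dots> = inv a \<otimes> r [^] i \<otimes> a"
      using int_pow_conjugate[of "inv a" r i] a rc by simp
    finally have "y = r [^] i"
      using a yc rc by (simp add: m_assoc)
    then show ?thesis ..
  qed
  with r show ?thesis by blast
qed

section \<open>Words that commute without cancellation\<close>

lemma commute_concat_replicate:
  "y @ c = c @ y \<Longrightarrow> y @ concat (replicate n c) = concat (replicate n c) @ y"
proof (induction n)
  case (Suc n)
  have "y @ concat (replicate (Suc n) c) = c @ y @ concat (replicate n c)"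
    using Suc.prems by (metis append.assoc concat.simps(2) replicate_Suc)
  with Suc show ?case by simp
qed simp

text \<open>A word commuting with \<open>c\<close> commutes with every power of \<open>c\<close>,
  hence is a prefix of each power that is long enough. Thus \<open>r\<close> and \<open>y\<close>
  are prefixes of one word.\<close>

lemma commuting_words_prefix:
  assumes "y @ c = c @ y" "r @ c = c @ r" "c \<noteq> []" "length r \<le> length y"
  obtains z where "y = r @ z"
proof -
  \<comment> \<open>Since \<open>c\<close> has at least one letter, this exponent makes the power at
    least as long as \<open>y\<close>.\<close>
  let ?p = "concat (replicate (length y) c)"
  have "length y * 1 \<le> length y * length c"
    using assms(3) by (intro mult_le_mono2) (simp add: Suc_leI)
  then have len: "length y \<le> length ?p"
    by (simp add: length_concat sum_list_replicate)
  have "y = take (length y) ?p"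
    using arg_cong[OF commute_concat_replicate[OF assms(1)], of "take (length y)" "length y"] len
    by simp
  moreover have "r = take (length r) ?p"
    using arg_cong[OF commute_concat_replicate[OF assms(2)], of "take (length r)" "length y"] len assms(4)
    by simp
  ultimately have "y = r @ drop (length r) y"
    using assms(4) by (metis append_take_drop_id min.absorb1 take_take)
  then show ?thesis by (rule that)
qed

text \<open>If \<open>y @ c\<close> is reduced, it is the reduced form of \<open>c @ y\<close> and
  has the same length, so nothing cancels there either. Otherwise \<open>y @ rev_path c\<close> is
  reduced, and the same argument applies to the inverse of \<open>c\<close>; reversal gives the
  second alternative.\<close>

lemma commute_cyclically_reduced:
  assumes "progressing y" "progressing (c @ c)" "pi_mult y c = pi_mult c y"
  shows "y @ c = c @ y \<or> rev_path y @ c = c @ rev_path y"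
proof -
  have no_cancel: "y @ d = d @ y" if "progressing (y @ d)" "pi_mult y d = pi_mult d y" for d
  proof -
    have "reduce_walk (d @ y) = y @ d"
      using that by (simp add: pi_mult_def)
    then have "length (reduce_walk (d @ y)) = length (d @ y)" by simp
    then show ?thesis
      using reduce_walk_invariants[of "d @ y"] \<open>reduce_walk (d @ y) = y @ d\<close> by metis
  qed
  have c: "progressing c"
    using assms(2) by (rule progressing_appendD1)
  show ?thesis
  proof (cases "progressing (y @ c)")
    case True
    with assms(3) no_cancel show ?thesis by blast
  next
    case False
    then have ne: "y \<noteq> []" "c \<noteq> []" and "last y = prod.swap (hd c)"
      using assms(1) c by (auto simp: progressing_append_iff prod_eq_iff)
    \<comment> \<open>This is cyclic reducedness of \<open>c\<close>: the last letter of
      \<open>y\<close>, which cancels against the start of \<open>c\<close>, cannot also cancel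
      against the inverse of the end of \<open>c\<close>.\<close>
    moreover have "last c \<noteq> prod.swap (hd c)"
      using assms(2) ne by (auto simp: progressing_append_iff prod_eq_iff)
    ultimately have "progressing (y @ rev_path c)"
      using assms(1) c by (auto simp: progressing_append_iff progressing_rev_path hd_rev_path prod_eq_iff)
    moreover have "pi_mult y (rev_path c) = pi_mult (rev_path c) y"
      using reduced_words.commute_inv[of y c] assms(1,3) c by simp
    ultimately have "y @ rev_path c = rev_path c @ y"
      by (rule no_cancel)
    then have "rev_path (y @ rev_path c) = rev_path (rev_path c @ y)" by simp
    then show ?thesis by simp
  qed
qed

text \<open>
  Words commuting with \<open>c\<close> without cancellation are prefixes of powers of \<open>c\<close>, hence the shortest
  nonempty one in \<open>S\<close> is a prefix of all the others and can be split off repeatedly.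
\<close>

lemma centralizer_cyclic_cyclically_reduced:
  assumes "progressing (c @ c)" "c \<noteq> []" "subgroup S reduced_words"
  shows "\<exists>R\<in>S. \<forall>y\<in>S. pi_mult c y = pi_mult y c \<longrightarrow> (\<exists>i::int. y = R [^]\<^bsub>reduced_words\<^esub> i)"
proof -
  interpret S: subgroup S reduced_words by fact
  have S: "progressing y" if "y \<in> S" for y
    using S.subset that by auto
  define M where "M = {w\<in>S. w \<noteq> [] \<and> w @ c = c @ w}"
  \<comment> \<open>If \<open>M\<close> is empty, then \<open>[]\<close> is the only word in
    \<open>S\<close> with \<open>w @ c = c @ w\<close>, and \<open>R = []\<close> generates
    it.\<close>
  define R where "R = (if M = {} then [] else arg_min length (\<lambda>w. w \<in> M))"
  have M: "arg_min length (\<lambda>w. w \<in> M) \<in> M" if "M \<noteq> {}"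
    using that by (metis arg_min_natI ex_in_conv)
  have R: "R \<in> S" "R @ c = c @ R" 
    using S.one_closed M by (auto simp: R_def M_def)
  have min: "R \<noteq> [] \<and> length R \<le> length y" if "y \<in> M" for y
    using that M arg_min_nat_le[of "\<lambda>w. w \<in> M" y length] by (auto simp: R_def M_def)
  have pow: "\<exists>n::nat. y = R [^]\<^bsub>reduced_words\<^esub> n" if "y \<in> S" "y @ c = c @ y" for y
    using that
  proof (induction y rule: length_induct)
    case (1 y)
    show ?case
    proof (cases "y = []")
      case True
      then show ?thesis by (intro exI[of _ 0]) simp
    next
      case False
      then have "R \<noteq> []" "length R \<le> length y"
        using min 1(2,3) by (auto simp: M_def)
      then obtain z where z: "y = R @ z"
        using commuting_words_prefix[OF 1(3) R(2) assms(2)] by blast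
      have pz: "progressing z" "pi_mult R z = y"
        using S[OF 1(2)] unfolding z by (auto simp: pi_mult_def dest: progressing_appendD2)
      \<comment> \<open>The remainder after splitting off the prefix \<open>R\<close> is a product
        in the group, so it stays in \<open>S\<close>.\<close>
      have "z = pi_mult (rev_path R) y"
        using reduced_words.inv_solve_left[of z R y] pz R S 1(2) by simp
      then have "z \<in> S"
        using S.m_closed[OF S.m_inv_closed[OF R(1)] 1(2)] S[OF R(1)] by simp
      moreover have "z @ c = c @ z"
        using 1(3) R(2) unfolding z by (metis append.assoc same_append_eq)
      moreover have "length z < length y"
        using z \<open>R \<noteq> []\<close> by simp
      ultimately obtain n :: nat where "z = R [^]\<^bsub>reduced_words\<^esub> n"
        using 1(1) by blast
      then have "y = R [^]\<^bsub>reduced_words\<^esub> Suc n"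
        using pz(2) S[OF R(1)] reduced_words.nat_pow_Suc2[of R n] by simp
      then show ?thesis ..
    qed
  qed
  have "\<exists>i::int. y = R [^]\<^bsub>reduced_words\<^esub> i" if y: "y \<in> S" and comm: "pi_mult c y = pi_mult y c" for y
  proof -
    \<comment> \<open>The first case yields exponents \<open>\<ge> 0\<close>, the second exponents
      \<open>\<le> 0\<close>.\<close>
    consider "y @ c = c @ y" | "rev_path y @ c = c @ rev_path y"
      using commute_cyclically_reduced[OF S[OF y] assms(1)] comm by metis
    then show ?thesis
    proof cases
      case 1
      then obtain n :: nat where "y = R [^]\<^bsub>reduced_words\<^esub> n"
        using pow y by blast
      then have "y = R [^]\<^bsub>reduced_words\<^esub> int n"
        by (simp add: int_pow_int)
      then show ?thesis ..
    next
      case 2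
      then obtain n :: nat where "rev_path y = R [^]\<^bsub>reduced_words\<^esub> n"
        using pow[of "rev_path y"] S.m_inv_closed[OF y] S[OF y] by auto
      then have "y = inv\<^bsub>reduced_words\<^esub> (R [^]\<^bsub>reduced_words\<^esub> n)"
        using S[OF y] by (metis inv_reduced_words progressing_rev_path rev_path_rev_path)
      then have "y = R [^]\<^bsub>reduced_words\<^esub> (- int n)"
        using S[OF R(1)] by (simp add: reduced_words.int_pow_neg_int)
      then show ?thesis ..
    qed
  qed
  with R(1) show ?thesis by blast
qed

text \<open>A word that is not cyclically reduced has the form \<open>e z e^-1\<close> with
  \<open>z\<close> shorter, and conjugation by \<open>e\<close> transfers the claim from
  \<open>z\<close>. The subgroup \<open>S\<close> is conjugated along, so it varies in the
  induction.\<close>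

lemma centralizer_cyclic:
  assumes "progressing x" "x \<noteq> []" "\<forall>e\<in>set x. fst e \<noteq> snd e" "subgroup S reduced_words"
  shows "\<exists>R\<in>S. \<forall>y\<in>S. pi_mult x y = pi_mult y x \<longrightarrow> (\<exists>i::int. y = R [^]\<^bsub>reduced_words\<^esub> i)"
  using assms
proof (induction x arbitrary: S rule: length_induct)
  case (1 x)
  interpret S: subgroup S reduced_words by fact
  show ?case
  proof (cases "progressing (x @ x)")
    case True
    then show ?thesis
      using centralizer_cyclic_cyclically_reduced 1 by blast
  next
    case False
    then have last: "last x = prod.swap (hd x)"
      using 1(2,3) by (auto simp: progressing_append_iff prod_eq_iff)
    obtain e w where x: "x = e # w"
      using 1(3) by (cases x) auto
    \<comment> \<open>If \<open>x\<close> were \<open>[e]\<close>, then \<open>e\<close> would be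
      its own inverse, that is, a loop.\<close>
    have "w \<noteq> []"
      using last 1(4) unfolding x by (auto simp: prod_eq_iff)
    then obtain z where z: "x = e # z @ [prod.swap e]"
      using last unfolding x by (cases w rule: rev_cases) auto
    \<comment> \<open>With \<open>z\<close> empty, \<open>x\<close> would consist of two cancelling
      letters.\<close>
    have pz: "progressing z" "z \<noteq> []"
      using 1(2) unfolding z
      by (auto simp: progressing_Cons progressing_append_iff prod.swap_def)
    let ?E = "[e]"
    let ?S = "(\<lambda>s. pi_mult (pi_mult (rev_path ?E) s) ?E) ` S"
    have E: "progressing ?E" by (rule progressing_single)
    have "subgroup ?S reduced_words"
      using reduced_words.subgroup_conjugate[OF 1(5), of ?E] E by simp
    then have "\<exists>R\<in>?S. \<forall>y\<in>?S. pi_mult z y = pi_mult y z \<longrightarrow> (\<exists>i::int. y = R [^]\<^bsub>reduced_words\<^esub> i)"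
      using 1(4) pz by (intro 1(1)[rule_format]) (auto simp: z)
    moreover have "pi_mult (pi_mult ?E z) (rev_path ?E) = x"
      using 1(2) by (simp add: pi_mult_def reduce_walk_append_left z prod.swap_def)
    ultimately show ?thesis
      using reduced_words.centralizer_cyclic_conjugate[OF 1(5), of ?E z] E pz by simp
  qed
qed

text \<open>Inside the whole group, \<open>u\<close> and \<open>v\<close> are powers of one element.
  So commuting is transitive through a nontrivial loopless word.\<close>

lemma centralizer_commutative:
  assumes "progressing x" "x \<noteq> []" "\<forall>e\<in>set x. fst e \<noteq> snd e"
    and "progressing u" "pi_mult x u = pi_mult u x"
    and "progressing v" "pi_mult x v = pi_mult v x"
  shows "pi_mult u v = pi_mult v u"
proof -
  obtain R where "progressing R" and
    "\<And>y. progressing y \<Longrightarrow> pi_mult x y = pi_mult y x \<Longrightarrow> \<exists>i::int. y = R [^]\<^bsub>reduced_words\<^esub> i"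
    using centralizer_cyclic[OF assms(1-3) reduced_words.subgroup_self] by auto
  moreover from this obtain i j :: int
    where "u = R [^]\<^bsub>reduced_words\<^esub> i" "v = R [^]\<^bsub>reduced_words\<^esub> j"
    using assms(4-7) by meson
  ultimately show ?thesis
    using reduced_words.int_pow_mult[of R i j] reduced_words.int_pow_mult[of R j i]
    by (simp add: add.commute)
qed

text \<open>A reduced word equal to its inverse would have a loop as its middle letter.\<close>

lemma odd_square_nontrivial:
  assumes "progressing z" "\<forall>e\<in>set z. fst e \<noteq> snd e" "odd (length z)"
  shows "pi_mult z z \<noteq> []"
proof
  assume "pi_mult z z = []"
  then have sym: "rev_path z = z"
    using reduced_words.inv_equality[of z z] assms(1) by simp
  \<comment> \<open>For odd length this is the middle position, which reversal fixes.\<close>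
  let ?n = "length z div 2"
  have n: "?n < length z" "length z - Suc ?n = ?n"
    using assms(3) by presburger+
  then have "z ! ?n = prod.swap (z ! ?n)"
    using arg_cong[OF sym, of "\<lambda>w. w ! ?n"] by (simp add: rev_path_conv_rev rev_nth)
  moreover have "z ! ?n \<in> set z"
    using n(1) by simp
  ultimately show False
    using assms(2) by (metis fst_swap)
qed

section \<open>Walks of even length\<close>

text \<open>
  A chain lists only the vertices in even position of a walk of even length. This suffices, since
  in a square-free graph the reduction of a walk of length two depends only on its end points.
\<close>

definition chain :: "('a \<times> 'a) set \<Rightarrow> 'a \<Rightarrow> 'a list \<Rightarrow> 'a \<Rightarrow> bool" where
  "chain A u xs v \<longleftrightarrow> xs \<noteq> [] \<and> hd xs = u \<and> last xs = v \<and> successively (\<lambda>x y. (x, y) \<in> A O A) xs"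

text \<open>This is the class of any walk of length two from \<open>u\<close> to \<open>w\<close>.
  In a square-free graph the choice is unambiguous; the value is meaningful only if \<open>u\<close>
  and \<open>w\<close> have a common neighbour or coincide.\<close>

definition connector :: "'c pair_pre_digraph \<Rightarrow> 'c \<Rightarrow> 'c \<Rightarrow> ('c \<times> 'c) awalk" where
  "connector K u w = (if u = w then []
     else let k = SOME k. (u, k) \<in> parcs K \<and> (k, w) \<in> parcs K in [(u, k), (k, w)])"

text \<open>The vertex map \<open>f\<close> is a parameter, so that one product serves for \<mu> and
  for its restrictions to rows and columns. A chain with one vertex stands for the empty
  walk.\<close>

fun even_class :: "'c pair_pre_digraph \<Rightarrow> ('a \<Rightarrow> 'c) \<Rightarrow> 'a list \<Rightarrow> ('c \<times> 'c) awalk" where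
  "even_class K f (x # y # xs) = pi_mult (connector K (f x) (f y)) (even_class K f (y # xs))"
| "even_class K f xs = []"

lemma progressing_connector: "progressing (connector K u w)"
  by (auto simp: connector_def progressing_Nil progressing_Cons Let_def)

lemma progressing_pi_mult: "progressing (pi_mult V W)"
  by (simp add: pi_mult_def reduce_walk)

lemma progressing_even_class: "progressing (even_class K f xs)"
  by (induction K f xs rule: even_class.induct) (simp_all add: progressing_pi_mult progressing_Nil)

lemma pi_mult_assoc:
  "progressing U \<Longrightarrow> progressing V \<Longrightarrow> progressing W \<Longrightarrow>
    pi_mult (pi_mult U V) W = pi_mult U (pi_mult V W)"
  using reduced_words.m_assoc by simp

lemma pi_mult_Nil: "progressing W \<Longrightarrow> pi_mult W [] = W" "progressing W \<Longrightarrow> pi_mult [] W = W"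
  by (simp_all add: pi_mult_def)

lemma even_class_map: "even_class K f (map g xs) = even_class K (f \<circ> g) xs"
  by (induction xs rule: induct_list012) auto

lemma even_class_cong: "(\<And>x. x \<in> set xs \<Longrightarrow> f x = g x) \<Longrightarrow> even_class K f xs = even_class K g xs"
  by (induction xs rule: induct_list012) auto

text \<open>For \<open>u \<noteq> w\<close>, a second common neighbour besides \<open>k\<close>
  would close a square, so the chosen one is \<open>k\<close>. For \<open>u = w\<close> the two arcs
  cancel.\<close>

lemma reduce_walk_two_steps:
  assumes "pair_graph K" "square_free K" "(u, k) \<in> parcs K" "(k, w) \<in> parcs K"
  shows "reduce_walk [(u, k), (k, w)] = connector K u w"
proof (cases "u = w")
  case True
  then show ?thesis
    using reduce_walk_cancel[of "[]" u k "[]"] by (simp add: connector_def progressing_Nil)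
next
  case False
  interpret K: pair_graph K by fact
  define l where "l = (SOME k. (u, k) \<in> parcs K \<and> (k, w) \<in> parcs K)"
  have l: "(u, l) \<in> parcs K" "(l, w) \<in> parcs K"
    using someI[of "\<lambda>k. (u, k) \<in> parcs K \<and> (k, w) \<in> parcs K" k] assms(3,4)
    by (simp_all add: l_def)
  have sym: "(w, l) \<in> parcs K" "(l, u) \<in> parcs K"
    using l K.arcs_symmetric by blast+
  have "u \<noteq> k" "u \<noteq> l" "w \<noteq> k" "w \<noteq> l"
    using assms(3,4)[THEN K.pair_no_loops] l[THEN K.pair_no_loops] by auto
  moreover have "\<not> distinct [u, k, w, l]"
    using assms(2-4) sym unfolding square_free_def by blast
  ultimately have "l = k"
    using False by auto
  moreover have "connector K u w = [(u, l), (l, w)]"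
    using False by (simp add: connector_def l_def Let_def)
  ultimately show ?thesis
    using False by (simp add: progressing_Cons)
qed

text \<open>Two arcs are consumed at a time, each pair giving one connector. The arc set
  \<open>A\<close> is left open to cover the whole product and its subgraphs.\<close>

lemma even_walk_class:
  assumes "pair_graph K" "square_free K" "\<And>p q. (p, q) \<in> A \<Longrightarrow> (f p, f q) \<in> parcs K"
    and "set W \<subseteq> A" "pcas p W q" "even (length W)"
  shows "\<exists>ps. chain A p ps q \<and> reduce_walk (walk_image f W) = even_class K f ps"
  using assms(4-6)
proof (induction W arbitrary: p rule: induct_list012)
  case 1
  then show ?case
    \<comment> \<open>Chains list vertices, so the empty walk at \<open>p\<close> becomes
      \<open>[p]\<close>.\<close>
    by (intro exI[of _ "[p]"]) (simp add: chain_def walk_image_def progressing_Nil)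
next
  case (2 e)
  then show ?case by simp
next
  case (3 d e W)
  obtain m r where de: "d = (p, m)" "e = (m, r)"
    using 3(4) by (cases d, cases e) auto
  have "set W \<subseteq> A" "pcas r W q" "even (length W)"
    using 3(3-5) de by simp_all
  then obtain ps where ps: "chain A r ps q" "reduce_walk (walk_image f W) = even_class K f ps"
    using 3(1) by blast
  then obtain ps' where ps': "ps = r # ps'"
    by (cases ps) (auto simp: chain_def)
  have "chain A p (p # ps) q"
    using ps(1) 3(3) de by (auto simp: ps' chain_def)
  moreover have "reduce_walk (walk_image f (d # e # W)) = even_class K f (p # ps)"
  proof -
    have "reduce_walk (walk_image f (d # e # W)) =
        pi_mult (reduce_walk [(f p, f m), (f m, f r)]) (reduce_walk (walk_image f W))"
      by (simp add: pi_mult_reduce_walk walk_image_def de)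
    also have "reduce_walk [(f p, f m), (f m, f r)] = connector K (f p) (f r)"
      using 3(3) de assms(1-3) by (intro reduce_walk_two_steps) auto
    finally show ?thesis
      by (simp add: ps(2)) (simp add: ps')
  qed
  ultimately show ?case by blast
qed

text \<open>The predicate \<open>P\<close> is a proper 2-colouring of \<open>A\<close>, and every
  arc of the walk switches the colour.\<close>

lemma even_length_if_alternating:
  fixes P :: "'a \<Rightarrow> bool"
  assumes "\<And>p q. (p, q) \<in> A \<Longrightarrow> P p \<noteq> P q" "set W \<subseteq> A" "pcas p W q"
  shows "even (length W) \<longleftrightarrow> P p = P q"
  using assms(2,3)
proof (induction W arbitrary: p)
  case (Cons e W)
  then have e: "e = (p, snd e)" "e \<in> A" and W: "set W \<subseteq> A" "pcas (snd e) W q"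
    by (auto simp: prod_eq_iff)
  have "P p \<noteq> P (snd e)"
    using assms(1)[of p "snd e"] e by metis
  with Cons.IH[OF W] show ?case by auto
qed simp

lemma chain_alternating:
  fixes P :: "'a \<Rightarrow> bool"
  assumes "\<And>p q. (p, q) \<in> A \<Longrightarrow> P p \<noteq> P q" "chain A p ps q" "P p"
  shows "\<forall>r\<in>set ps. P r"
  using assms(2,3)
proof (induction ps arbitrary: p)
  case Nil
  show ?case by simp
next
  case (Cons x ps)
  then have "P x" by (simp add: chain_def)
  show ?case
  proof (cases ps)
    case Nil
    with \<open>P x\<close> show ?thesis by simp
  next
    case (Cons y ys)
    with Cons.prems(1) have "(x, y) \<in> A O A" and y: "chain A y ps q"
      by (auto simp: chain_def)
    then obtain z where "(x, z) \<in> A" "(z, y) \<in> A" by blast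
    from this[THEN assms(1)] \<open>P x\<close> have "P y" by simp
    with Cons.IH[OF y] \<open>P x\<close> show ?thesis by simp
  qed
qed

lemma chain_map:
  assumes "chain A p ps q" "\<And>x y. (x, y) \<in> A \<Longrightarrow> (f x, f y) \<in> B"
  shows "chain B (f p) (map f ps) (f q)"
proof -
  have "successively (\<lambda>x y. (f x, f y) \<in> B O B) ps"
  proof (rule successively_mono)
    show "successively (\<lambda>x y. (x, y) \<in> A O A) ps"
      using assms(1) by (simp add: chain_def)
  qed (use assms(2) in blast)
  then show ?thesis
    using assms(1) by (auto simp: chain_def successively_map hd_map last_map)
qed

section \<open>Rows and columns of the product\<close>

locale square_free_product_hom =
  fixes G :: "'a pair_pre_digraph" and H :: "'b pair_pre_digraph" and K :: "'c pair_pre_digraph"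
    and \<mu> :: "'a \<times> 'b \<Rightarrow> 'c"
  assumes G: "pair_graph G" and H: "pair_graph H" and K: "pair_graph K"
    and square_free: "square_free K"
    and hom: "graph_hom \<mu> (tensor_product G H) K"
begin

text \<open>The product has no arcs inside a row or a column. Chains can still run along a row,
  since two steps may return to the same second coordinate; likewise for columns.\<close>

abbreviation "row b \<equiv> even_class K (\<lambda>a. \<mu> (a, b))"
abbreviation "column a \<equiv> even_class K (\<lambda>b. \<mu> (a, b))"
abbreviation "conn p q \<equiv> connector K (\<mu> p) (\<mu> q)"

lemma hom_arc: "(a, a') \<in> parcs G \<Longrightarrow> (b, b') \<in> parcs H \<Longrightarrow> (\<mu> (a, b), \<mu> (a', b')) \<in> parcs K"
  using hom by (auto simp: graph_hom_def tensor_product_def)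

text \<open>The vertex \<open>(m, n)\<close> is adjacent to all four corners of the rectangle, so
  every connector between corners is the reduced walk through its image. In a composite the middle
  detour cancels.\<close>

lemma conn_via_corner:
  assumes "(a, c) \<in> parcs G O parcs G" "(b, d) \<in> parcs H O parcs H"
  shows "conn (a, b) (c, d) = pi_mult (conn (a, b) (c, b)) (conn (c, b) (c, d))"
    and "conn (a, b) (c, d) = pi_mult (conn (a, b) (a, d)) (conn (a, d) (c, d))"
proof -
  interpret G: pair_graph G by (rule G)
  interpret H: pair_graph H by (rule H)
  obtain m n where mn: "(a, m) \<in> parcs G" "(m, c) \<in> parcs G" "(b, n) \<in> parcs H" "(n, d) \<in> parcs H"
    using assms by blast
  have sym: "(c, m) \<in> parcs G" "(m, a) \<in> parcs G" "(d, n) \<in> parcs H" "(n, b) \<in> parcs H"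
    using mn G.arcs_symmetric H.arcs_symmetric by blast+
  have conn: "conn p q = reduce_walk [(\<mu> p, \<mu> (m, n)), (\<mu> (m, n), \<mu> q)]"
    if "p \<in> {a, c} \<times> {b, d}" "q \<in> {a, c} \<times> {b, d}" for p q
    by (rule reduce_walk_two_steps[OF K square_free, symmetric])
      (use that mn sym in \<open>auto intro: hom_arc\<close>)
  have "conn p q = pi_mult (conn p r) (conn r q)"
    if "p \<in> {a, c} \<times> {b, d}" "r \<in> {a, c} \<times> {b, d}" "q \<in> {a, c} \<times> {b, d}" for p r q
    using that
      reduce_walk_cancel[of "[(\<mu> p, \<mu> (m, n))]" "\<mu> (m, n)" "\<mu> r" "[(\<mu> (m, n), \<mu> q)]"]
    by (simp add: conn pi_mult_reduce_walk)
  then show "conn (a, b) (c, d) = pi_mult (conn (a, b) (c, b)) (conn (c, b) (c, d))"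
    and "conn (a, b) (c, d) = pi_mult (conn (a, b) (a, d)) (conn (a, d) (c, d))"
    by simp_all
qed

text \<open>Both ways around a rectangle equal its diagonal by \<open>conn_via_corner\<close>. So
  the column step slides along the row, one rectangle at a time, from column \<open>c\<close> to
  column \<open>a\<close>.\<close>

lemma row_conn:
  assumes "chain (parcs G) a as c" "(b, d) \<in> parcs H O parcs H"
  shows "pi_mult (row b as) (conn (c, b) (c, d)) = pi_mult (conn (a, b) (a, d)) (row d as)"
  using assms(1)
proof (induction as arbitrary: a rule: induct_list012)
  case 1
  then show ?case by (simp add: chain_def)
next
  case (2 x)
  then show ?case by (auto simp: chain_def pi_mult_Nil progressing_connector)
next
  case (3 x y as)
  have x: "x = a" and xy: "(a, y) \<in> parcs G O parcs G" and y: "chain (parcs G) y (y # as) c"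
    using 3(3) by (auto simp: chain_def)
  have "pi_mult (row b (x # y # as)) (conn (c, b) (c, d)) =
      pi_mult (conn (a, b) (y, b)) (pi_mult (row b (y # as)) (conn (c, b) (c, d)))"
    by (simp add: x pi_mult_assoc progressing_connector progressing_even_class)
  also have "\<dots> = pi_mult (pi_mult (conn (a, b) (y, b)) (conn (y, b) (y, d))) (row d (y # as))"
    unfolding 3(2)[OF y] by (simp add: pi_mult_assoc progressing_connector progressing_even_class)
  also have "\<dots> = pi_mult (pi_mult (conn (a, b) (a, d)) (conn (a, d) (y, d))) (row d (y # as))"
    using conn_via_corner[OF xy assms(2)] by simp
  also have "\<dots> = pi_mult (conn (a, b) (a, d)) (row d (x # y # as))"
    by (simp add: x pi_mult_assoc progressing_connector progressing_even_class)
  finally show ?case .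
qed

text \<open>The row is moved past the column one column step at a time by \<open>row_conn\<close>.
  For \<open>a = c\<close> and \<open>b = d\<close> this says that the two kinds of closed classes
  commute.\<close>

lemma row_column:
  assumes "chain (parcs G) a as c" "chain (parcs H) b bs d"
  shows "pi_mult (row b as) (column c bs) = pi_mult (column a bs) (row d as)"
  using assms(2)
proof (induction bs arbitrary: b rule: induct_list012)
  case 1
  then show ?case by (simp add: chain_def)
next
  case (2 x)
  then show ?case by (auto simp: chain_def pi_mult_Nil progressing_even_class)
next
  case (3 x y bs)
  have x: "x = b" and xy: "(b, y) \<in> parcs H O parcs H" and y: "chain (parcs H) y (y # bs) d"
    using 3(3) by (auto simp: chain_def)
  have "pi_mult (row b as) (column c (x # y # bs)) =
      pi_mult (pi_mult (row b as) (conn (c, b) (c, y))) (column c (y # bs))"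
    by (simp add: x pi_mult_assoc progressing_connector progressing_even_class)
  also have "\<dots> = pi_mult (conn (a, b) (a, y)) (pi_mult (row y as) (column c (y # bs)))"
    unfolding row_conn[OF assms(1) xy]
    by (simp add: pi_mult_assoc progressing_connector progressing_even_class)
  also have "\<dots> = pi_mult (column a (x # y # bs)) (row d as)"
    unfolding 3(2)[OF y] by (simp add: x pi_mult_assoc progressing_connector progressing_even_class)
  finally show ?case .
qed

text \<open>Each diagonal step is split at a corner into a row step and a column step, and the
  column step is moved past the rest of the row.\<close>

lemma even_class_decompose:
  assumes "chain (parcs (tensor_product G H)) (a, b) ps (c, d)"
  shows "even_class K \<mu> ps = pi_mult (row b (map fst ps)) (column c (map snd ps))"
  using assms
proof (induction ps arbitrary: a b rule: induct_list012)
  case 1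
  then show ?case by (simp add: chain_def)
next
  case (2 p)
  then show ?case by (simp add: pi_mult_Nil progressing_Nil)
next
  case (3 p q ps)
  obtain a' b' where q: "q = (a', b')" by (cases q)
  have p: "p = (a, b)" and pq: "((a, b), (a', b')) \<in> parcs (tensor_product G H) O parcs (tensor_product G H)"
    and ch: "chain (parcs (tensor_product G H)) (a', b') (q # ps) (c, d)"
    using 3(3) q by (auto simp: chain_def)
  have xy: "(a, a') \<in> parcs G O parcs G" "(b, b') \<in> parcs H O parcs H"
    using pq by (auto simp: tensor_product_def)
  have fst: "chain (parcs G) a' (map fst (q # ps)) c"
    using chain_map[OF ch, of fst "parcs G"] by (auto simp: tensor_product_def)
  have "even_class K \<mu> (p # q # ps) = pi_mult (pi_mult (conn (a, b) (a', b)) (conn (a', b) (a', b')))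
      (pi_mult (row b' (map fst (q # ps))) (column c (map snd (q # ps))))"
    using 3(2)[OF ch] conn_via_corner(1)[OF xy] by (simp add: p q)
  also have "\<dots> = pi_mult (conn (a, b) (a', b))
      (pi_mult (pi_mult (conn (a', b) (a', b')) (row b' (map fst (q # ps)))) (column c (map snd (q # ps))))"
    by (simp only: pi_mult_assoc progressing_connector progressing_even_class progressing_pi_mult)
  \<comment> \<open>The column step leaves column \<open>a'\<close> and arrives in column
    \<open>c\<close>, while the row drops from \<open>b'\<close> to \<open>b\<close>.\<close>
  also have "\<dots> = pi_mult (conn (a, b) (a', b))
      (pi_mult (pi_mult (row b (map fst (q # ps))) (conn (c, b) (c, b'))) (column c (map snd (q # ps))))"
    unfolding row_conn[OF fst xy(2)] ..
  also have "\<dots> = pi_mult (row b (map fst (p # q # ps))) (column c (map snd (p # q # ps)))"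
    by (simp add: p q pi_mult_assoc progressing_connector progressing_even_class progressing_pi_mult)
  finally show ?case .
qed

end

section \<open>Closed walks\<close>

lemma pcas_append: "pcas u (V @ W) w \<longleftrightarrow> (\<exists>v. pcas u V v \<and> pcas v W w)"
  by (induction V arbitrary: u) auto

lemma pcas_rev_path: "pcas u W v \<Longrightarrow> pcas v (rev_path W) u"
  by (induction W arbitrary: u) (auto simp: pcas_append)

lemma pcas_walk_image: "pcas u W v \<Longrightarrow> pcas (f u) (walk_image f W) (f v)"
  by (induction W arbitrary: u) (auto simp: walk_image_def)

lemma mem_pi_hom_iff:
  "W \<in> pi_hom K u v \<longleftrightarrow> u \<in> pverts K \<and> set W \<subseteq> parcs K \<and> pcas u W v \<and> progressing W"
  by (auto simp: pi_hom_def pre_digraph.awalk_def cas_with_proj_eq)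

lemma reduce_walk_in_pi_hom:
  assumes "u \<in> pverts K" "set W \<subseteq> parcs K" "pcas u W v"
  shows "reduce_walk W \<in> pi_hom K u v"
  using assms reduce_walk_invariants[of W u v] reduce_walk(2)[of W] by (auto simp: mem_pi_hom_iff)

text \<open>The vertex group of the groupoid embeds in the group of all reduced words, so the facts
  on centralizers apply within it.\<close>

lemma subgroup_pi_hom:
  assumes "pair_graph K" "v \<in> pverts K"
  shows "subgroup (pi_hom K v v) reduced_words"
proof -
  interpret K: pair_graph K by fact
  show ?thesis
  proof (rule reduced_words.subgroupI)
    show "pi_hom K v v \<subseteq> {W. progressing W}" by (auto simp: mem_pi_hom_iff)
    show "pi_hom K v v \<noteq> {}"
      using assms(2) mem_pi_hom_iff[of "[]" K v v] by (auto simp: progressing_Nil)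
  next
    fix W
    assume W: "W \<in> pi_hom K v v"
    have "set (rev_path W) \<subseteq> parcs K"
      using W K.arcs_symmetric by (auto simp: set_rev_path mem_pi_hom_iff)
    then show "inv\<^bsub>reduced_words\<^esub> W \<in> pi_hom K v v"
      using W by (simp add: mem_pi_hom_iff progressing_rev_path pcas_rev_path)
  next
    fix V W
    assume VW: "V \<in> pi_hom K v v" "W \<in> pi_hom K v v"
    then have "pcas v (V @ W) v"
      unfolding pcas_append mem_pi_hom_iff by blast
    then show "pi_mult V W \<in> pi_hom K v v"
      unfolding pi_mult_def using VW
      by (intro reduce_walk_in_pi_hom) (auto simp: mem_pi_hom_iff)
  qed
qed

lemma awalk_induce_subgraph_iff:
  "pre_digraph.awalk (with_proj \<Gamma> \<restriction> S) u W v \<longleftrightarrow>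
    u \<in> S \<and> set W \<subseteq> {e \<in> parcs \<Gamma>. fst e \<in> S \<and> snd e \<in> S} \<and> pcas u W v"
proof -
  have "pre_digraph.cas (with_proj \<Gamma> \<restriction> S) u W v = pcas u W v" for u
    by (induction W arbitrary: u) (simp_all add: pre_digraph.cas.simps)
  then show ?thesis
    by (simp add: pre_digraph.awalk_def)
qed

context square_free_product_hom
begin

text \<open>The second coordinate 2-colours the subgraph, as \<open>h0 \<noteq> h1\<close>. Hence a
  closed walk has even length and its even vertices stay in row \<open>h0\<close>.\<close>

lemma row_class:
  assumes "(h0, h1) \<in> parcs H"
    and "pre_digraph.awalk (with_proj (tensor_product G H) \<restriction> (pverts G \<times> {h0, h1})) (g, h0) C (g, h0)"
  obtains as where "chain (parcs G) g as g" "reduce_walk (walk_image \<mu> C) = row h0 as"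
proof -
  interpret H: pair_graph H by (rule H)
  define A where "A = {e \<in> parcs (tensor_product G H).
    fst e \<in> pverts G \<times> {h0, h1} \<and> snd e \<in> pverts G \<times> {h0, h1}}"
  have C: "set C \<subseteq> A" "pcas (g, h0) C (g, h0)"
    using assms(2) by (auto simp: awalk_induce_subgraph_iff A_def)
  have alt: "(snd p = h0) \<noteq> (snd q = h0)" if "(p, q) \<in> A" for p q
    using that H.no_loops'[OF assms(1)] H.no_loops'[of h0 h0] H.no_loops'[of h1 h1]
    by (auto simp: A_def tensor_product_def)
  have "even (length C)"
    using even_length_if_alternating[of A "\<lambda>p. snd p = h0", OF alt C] by simp
  moreover have "(\<mu> p, \<mu> q) \<in> parcs K" if "(p, q) \<in> A" for p q
    using that by (auto simp: A_def tensor_product_def intro: hom_arc)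
  ultimately obtain ps where ps: "chain A (g, h0) ps (g, h0)"
      "reduce_walk (walk_image \<mu> C) = even_class K \<mu> ps"
    using even_walk_class[OF K square_free _ C] by blast
  have "\<forall>p\<in>set ps. snd p = h0"
    using chain_alternating[of A "\<lambda>p. snd p = h0", OF alt ps(1)] by simp
  then have "even_class K \<mu> ps = row h0 (map fst ps)"
    unfolding even_class_map by (intro even_class_cong)
      (auto simp: prod_eq_iff intro!: arg_cong[of _ _ \<mu>])
  moreover have "chain (parcs G) g (map fst ps) g"
    using chain_map[OF ps(1), of fst "parcs G"] by (auto simp: A_def tensor_product_def)
  ultimately show ?thesis
    using that ps(2) by simp
qed

text \<open>The same argument as for \<open>row_class\<close>, with the first coordinate as the
  colour.\<close>

lemma column_class:
  assumes "(g0, g1) \<in> parcs G"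
    and "pre_digraph.awalk (with_proj (tensor_product G H) \<restriction> ({g0, g1} \<times> pverts H)) (g0, h) D (g0, h)"
  obtains bs where "chain (parcs H) h bs h" "reduce_walk (walk_image \<mu> D) = column g0 bs"
proof -
  interpret G: pair_graph G by (rule G)
  define A where "A = {e \<in> parcs (tensor_product G H).
    fst e \<in> {g0, g1} \<times> pverts H \<and> snd e \<in> {g0, g1} \<times> pverts H}"
  have D: "set D \<subseteq> A" "pcas (g0, h) D (g0, h)"
    using assms(2) by (auto simp: awalk_induce_subgraph_iff A_def)
  have alt: "(fst p = g0) \<noteq> (fst q = g0)" if "(p, q) \<in> A" for p q
    using that G.no_loops'[OF assms(1)] G.no_loops'[of g0 g0] G.no_loops'[of g1 g1]
    by (auto simp: A_def tensor_product_def)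
  have "even (length D)"
    using even_length_if_alternating[of A "\<lambda>p. fst p = g0", OF alt D] by simp
  moreover have "(\<mu> p, \<mu> q) \<in> parcs K" if "(p, q) \<in> A" for p q
    using that by (auto simp: A_def tensor_product_def intro: hom_arc)
  ultimately obtain ps where ps: "chain A (g0, h) ps (g0, h)"
      "reduce_walk (walk_image \<mu> D) = even_class K \<mu> ps"
    using even_walk_class[OF K square_free _ D] by blast
  have "\<forall>p\<in>set ps. fst p = g0"
    using chain_alternating[of A "\<lambda>p. fst p = g0", OF alt ps(1)] by simp
  then have "even_class K \<mu> ps = column g0 (map snd ps)"
    unfolding even_class_map by (intro even_class_cong)
      (auto simp: prod_eq_iff intro!: arg_cong[of _ _ \<mu>])
  moreover have "chain (parcs H) h (map snd ps) h"
    using chain_map[OF ps(1), of snd "parcs H"] by (auto simp: A_def tensor_product_def)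
  ultimately show ?thesis
    using that ps(2) by simp
qed

text \<open>The chains \<open>as\<close> and \<open>bs\<close> are the coordinate projections of the
  even vertices of \<open>W\<close>; both are closed because \<open>W\<close> is.\<close>

lemma even_closed_class:
  assumes "set W \<subseteq> parcs (tensor_product G H)" "pcas (g, h) W (g, h)" "even (length W)"
  obtains as bs where "chain (parcs G) g as g" "chain (parcs H) h bs h"
    "reduce_walk (walk_image \<mu> W) = pi_mult (row h as) (column g bs)"
proof -
  have "(\<mu> p, \<mu> q) \<in> parcs K" if "(p, q) \<in> parcs (tensor_product G H)" for p q
    using that by (auto simp: tensor_product_def intro: hom_arc)
  then obtain ps where ps: "chain (parcs (tensor_product G H)) (g, h) ps (g, h)"
      "reduce_walk (walk_image \<mu> W) = even_class K \<mu> ps"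
    using even_walk_class[OF K square_free _ assms] by blast
  moreover have "chain (parcs G) g (map fst ps) g" "chain (parcs H) h (map snd ps) h"
    using chain_map[OF ps(1), of fst "parcs G"] chain_map[OF ps(1), of snd "parcs H"]
    by (auto simp: tensor_product_def)
  ultimately show ?thesis
    using that even_class_decompose[OF ps(1)] by simp
qed

lemma class_in_pi_hom:
  assumes "set W \<subseteq> parcs (tensor_product G H)" "pcas u W v" "u \<in> pverts (tensor_product G H)"
  shows "reduce_walk (walk_image \<mu> W) \<in> pi_hom K (\<mu> u) (\<mu> v)"
proof (rule reduce_walk_in_pi_hom)
  show "\<mu> u \<in> pverts K"
    using hom assms(3) by (simp add: graph_hom_def)
  show "set (walk_image \<mu> W) \<subseteq> parcs K"
    using hom assms(1) by (auto simp: graph_hom_def walk_image_def)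
  show "pcas (\<mu> u) (walk_image \<mu> W) (\<mu> v)"
    using assms(2) by (rule pcas_walk_image)
qed

end

section \<open>The trichotomy for closed walks\<close>

theorem theorem7:
  fixes G :: "'a pair_pre_digraph" and H :: "'b pair_pre_digraph" and K :: "'c pair_pre_digraph"
    and \<mu> :: "'a \<times> 'b \<Rightarrow> 'c" and g0 g1 :: 'a and h0 h1 :: 'b
  assumes "simple_graph G" and "simple_graph H" and "simple_graph K"
    and "square_free K"
    and "graph_hom \<mu> (tensor_product G H) K"
    and "(g0, g1) \<in> parcs G" and "(h0, h1) \<in> parcs H"
  shows
    "(\<forall>C. pre_digraph.awalk (with_proj (tensor_product G H) \<restriction> (pverts G \<times> {h0, h1}))
            (g0, h0) C (g0, h0) \<longrightarrow> reduce_walk (walk_image \<mu> C) = []) \<or>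
     (\<forall>D. pre_digraph.awalk (with_proj (tensor_product G H) \<restriction> ({g0, g1} \<times> pverts H))
            (g0, h0) D (g0, h0) \<longrightarrow> reduce_walk (walk_image \<mu> D) = []) \<or>
     (\<exists>R\<in>pi_hom K (\<mu> (g0, h0)) (\<mu> (g0, h0)).
        \<forall>C'. pre_digraph.awalk (with_proj (tensor_product G H)) (g0, h0) C' (g0, h0) \<longrightarrow>
          (\<exists>i::int. reduce_walk (walk_image \<mu> C') = pi_pow R i))"
proof -
  interpret square_free_product_hom G H K \<mu>
    using assms(1-5) by (simp add: square_free_product_hom_def simple_graph_def)
  interpret G: pair_graph G by (rule G)
  interpret H: pair_graph H by (rule H)
  interpret K: pair_graph K by (rule K)
  let ?\<Gamma> = "tensor_product G H"
  let ?red = "\<lambda>W. reduce_walk (walk_image \<mu> W)"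
  let ?S = "pi_hom K (\<mu> (g0, h0)) (\<mu> (g0, h0))"
  have base: "(g0, h0) \<in> pverts ?\<Gamma>"
    using assms(6)[THEN G.arc_fst_in_verts] assms(7)[THEN H.arc_fst_in_verts]
    by (simp add: tensor_product_def)
  have S: "?red W \<in> ?S" if "set W \<subseteq> parcs ?\<Gamma>" "pcas (g0, h0) W (g0, h0)" for W
    using class_in_pi_hom[OF that base] .
  have S_sub: "subgroup ?S reduced_words"
    using hom base by (intro subgroup_pi_hom K) (simp add: graph_hom_def)
  have loopless: "\<forall>e\<in>set W. fst e \<noteq> snd e" "progressing W" if "W \<in> ?S" for W
    using that K.pair_no_loops by (auto simp: mem_pi_hom_iff)
  have cyclic: "\<exists>R\<in>?S. \<forall>W. set W \<subseteq> parcs ?\<Gamma> \<and> pcas (g0, h0) W (g0, h0) \<longrightarrow>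
      (\<exists>i::int. ?red W = pi_pow R i)"
    if C: "pre_digraph.awalk (with_proj ?\<Gamma> \<restriction> (pverts G \<times> {h0, h1})) (g0, h0) C (g0, h0)" "?red C \<noteq> []"
      and D: "pre_digraph.awalk (with_proj ?\<Gamma> \<restriction> ({g0, g1} \<times> pverts H)) (g0, h0) D (g0, h0)" "?red D \<noteq> []"
    for C D
  proof -
    define x y where "x = ?red C" and "y = ?red D"
    have x: "x \<in> ?S" "x \<noteq> []" and y: "y \<in> ?S" "y \<noteq> []"
      using C D S[of C] S[of D] by (auto simp: x_def y_def awalk_induce_subgraph_iff)
    obtain as where as: "chain (parcs G) g0 as g0" "x = row h0 as"
      using row_class[OF assms(7) C(1)] unfolding x_def by blast
    obtain bs where bs: "chain (parcs H) h0 bs h0" "y = column g0 bs"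
      using column_class[OF assms(6) D(1)] unfolding y_def by blast
    \<comment> \<open>Commuting passes through a nontrivial \<open>v\<close>, whose centralizer is
      abelian.\<close>
    have trans: "pi_mult u w = pi_mult w u"
      if "v \<in> ?S" "v \<noteq> []" "progressing u" "progressing w"
        "pi_mult v u = pi_mult u v" "pi_mult v w = pi_mult w v" for u v w
      by (rule centralizer_commutative[OF loopless(2)[OF that(1)] that(2) loopless(1)[OF that(1)]
            that(3,5,4,6)])
    have even: "pi_mult x (?red W) = pi_mult (?red W) x"
      if W: "set W \<subseteq> parcs ?\<Gamma>" "pcas (g0, h0) W (g0, h0)" "even (length W)" for W
    proof -
      obtain as' bs' where as': "chain (parcs G) g0 as' g0" and bs': "chain (parcs H) h0 bs' h0"
        and red: "?red W = pi_mult (row h0 as') (column g0 bs')"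
        using even_closed_class[OF W] by blast
      have 1: "pi_mult x (column g0 bs') = pi_mult (column g0 bs') x"
        unfolding as(2) by (rule row_column[OF as(1) bs'])
      \<comment> \<open>Two row classes need not commute in general. Here the nontrivial column
        class \<open>y\<close> commutes with both, which is where the failure of (ii)
        enters.\<close>
      have 2: "pi_mult x (row h0 as') = pi_mult (row h0 as') x"
      proof (rule trans[OF y])
        show "progressing x" "progressing (row h0 as')"
          by (simp_all add: as(2) progressing_even_class)
        show "pi_mult y x = pi_mult x y"
          unfolding as(2) bs(2) by (rule row_column[OF as(1) bs(1), symmetric])
        show "pi_mult y (row h0 as') = pi_mult (row h0 as') y"
          unfolding bs(2) by (rule row_column[OF as' bs(1), symmetric])
      qed
      have "pi_mult x (?red W) = pi_mult (pi_mult x (row h0 as')) (column g0 bs')"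
        unfolding red using loopless(2)[OF x(1)] by (simp add: pi_mult_assoc progressing_even_class)
      also have "\<dots> = pi_mult (row h0 as') (pi_mult x (column g0 bs'))"
        unfolding 2 using loopless(2)[OF x(1)] by (simp add: pi_mult_assoc progressing_even_class)
      also have "\<dots> = pi_mult (?red W) x"
        unfolding 1 red using loopless(2)[OF x(1)] by (simp add: pi_mult_assoc progressing_even_class)
      finally show ?thesis .
    qed
    have all: "pi_mult x (?red W) = pi_mult (?red W) x"
      if W: "set W \<subseteq> parcs ?\<Gamma>" "pcas (g0, h0) W (g0, h0)" for W
    proof (cases "even (length W)")
      case True
      with W show ?thesis by (rule even)
    next
      case False
      define z where "z = ?red W"
      have z: "z \<in> ?S"
        using S[OF W] by (simp add: z_def)
      have odd: "odd (length z)"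
        using False reduce_walk_invariants[of "walk_image \<mu> W"] by (simp add: z_def walk_image_def)
      have zz: "pi_mult z z = ?red (W @ W)"
        by (simp add: z_def pi_mult_reduce_walk walk_image_def)
      have WW: "set (W @ W) \<subseteq> parcs ?\<Gamma>" "pcas (g0, h0) (W @ W) (g0, h0)" "even (length (W @ W))"
        using W pcas_append[of "(g0, h0)" W W "(g0, h0)"] by auto
      \<comment> \<open>The intermediate element is \<open>z z\<close>, the class of the even walk
        \<open>W @ W\<close>.\<close>
      have "pi_mult x z = pi_mult z x"
      proof (rule trans)
        show "pi_mult z z \<in> ?S" using S[OF WW(1,2)] zz by simp
        show "pi_mult z z \<noteq> []"
          by (rule odd_square_nontrivial[OF loopless(2,1)[OF z] odd])
        show "progressing x" "progressing z"
          by (fact loopless(2)[OF x(1)], fact loopless(2)[OF z])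
        show "pi_mult (pi_mult z z) x = pi_mult x (pi_mult z z)"
          unfolding zz by (rule even[OF WW, symmetric])
        show "pi_mult (pi_mult z z) z = pi_mult z (pi_mult z z)"
          using loopless(2)[OF z] by (simp add: pi_mult_assoc)
      qed
      then show ?thesis by (simp add: z_def)
    qed
    \<comment> \<open>The centralizer is taken within the vertex group, so \<open>R\<close> is
      itself a closed reduced walk of \<open>K\<close>.\<close>
    obtain R where R: "R \<in> ?S" and
      pow: "\<And>y. y \<in> ?S \<Longrightarrow> pi_mult x y = pi_mult y x \<Longrightarrow> \<exists>i::int. y = R [^]\<^bsub>reduced_words\<^esub> i"
      using centralizer_cyclic[OF loopless(2)[OF x(1)] x(2) loopless(1)[OF x(1)] S_sub] by blast
    have "\<exists>i::int. ?red W = pi_pow R i"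
      if W: "set W \<subseteq> parcs ?\<Gamma>" "pcas (g0, h0) W (g0, h0)" for W
      using pow[OF S[OF W] all[OF W]] unfolding pi_pow_conv_int_pow[OF loopless(2)[OF R]] .
    with R show ?thesis by blast
  qed
  consider (row) "\<forall>C. pre_digraph.awalk (with_proj ?\<Gamma> \<restriction> (pverts G \<times> {h0, h1})) (g0, h0) C (g0, h0)
      \<longrightarrow> ?red C = []"
    | (column) "\<forall>D. pre_digraph.awalk (with_proj ?\<Gamma> \<restriction> ({g0, g1} \<times> pverts H)) (g0, h0) D (g0, h0)
      \<longrightarrow> ?red D = []"
    | (neither) C D where
      "pre_digraph.awalk (with_proj ?\<Gamma> \<restriction> (pverts G \<times> {h0, h1})) (g0, h0) C (g0, h0)" "?red C \<noteq> []"
      "pre_digraph.awalk (with_proj ?\<Gamma> \<restriction> ({g0, g1} \<times> pverts H)) (g0, h0) D (g0, h0)" "?red D \<noteq> []"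
    by blast
  then show ?thesis
  proof cases
    case row
    then show ?thesis by (rule disjI1)
  next
    case column
    then show ?thesis by (intro disjI2 disjI1)
  next
    case neither
    from cyclic[OF this] show ?thesis
      by (intro disjI2) (simp add: pre_digraph.awalk_def cas_with_proj_eq base)
  qed
qed

end
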